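(* Let $a<b$ be real numbers and let $f,g:[a,b]\rightarrow\mathbb{R}$ be continuous on $[a,b]$ and differentiable on $(a,b)$. If $g'(t)\neq 0$ for each $t\in(a,b)$ and $$\left\Vert \frac{f'}{g'}\right\Vert_\infty:=\sup_{t\in(a,b)}\left\vert\frac{f'(t)}{g'(t)}\right\vert<\infty,$$ then for any $x\in[a,b]$ one has the inequality $$\left\vert f(x)-\frac{1}{b-a}\int_a^b f(t)\,dt\right\vert\leq\left\vert 2\left(\frac{x-\frac{a+b}{2}}{b-a}\right)g(x)+\frac{\int_x^b g(t)\,dt-\int_a^x g(t)\,dt}{b-a}\right\vert\cdot\left\Vert\frac{f'}{g'}\right\Vert_\infty.$$ *)

theory Defs
  imports "HOL-Analysis.Analysis"
begin

end

theory Submission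
  imports Defs
begin

text \<open>
  The left-hand side, multiplied by \<open>b - a\<close>, is the absolute value of the integral of
  \<open>f x - f t\<close> over \<open>t \<in> [a,b]\<close>. Cauchy's mean value theorem bounds the integrand by
  \<open>M * \<bar>g x - g t\<bar>\<close>, where \<open>M\<close> is the supremum of \<open>\<bar>f' / g'\<bar>\<close>
  (lemma \<open>increment_le_SUP_deriv_ratio\<close>), so everything reduces to the integral of
  \<open>\<bar>g x - g t\<bar>\<close>.

  By Rolle's theorem a continuous \<open>g\<close> whose derivative does not vanish is injective,
  hence strictly monotone. The difference \<open>g x - g t\<close> therefore changes sign exactly at
  \<open>t = x\<close>, and splitting the integral there evaluates it in closed form. The result is
  \<open>b - a\<close> times the first factor of the bound
  (lemma \<open>integral_abs_diff_monotone\<close>).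
\<close>

text \<open>
  The generalised mean value theorem with mere continuity at the endpoints. It is Rolle's theorem
  for the combination of \<open>f\<close> and \<open>g\<close> that takes equal values at \<open>u\<close> and \<open>v\<close>.
\<close>

lemma Cauchy_mean_value:
  fixes f g :: "real \<Rightarrow> real"
  assumes "u < v" "continuous_on {u..v} f" "continuous_on {u..v} g"
    and df: "\<And>z. z \<in> {u<..<v} \<Longrightarrow> f differentiable at z"
    and dg: "\<And>z. z \<in> {u<..<v} \<Longrightarrow> g differentiable at z"
  obtains z where "z \<in> {u<..<v}" "(f v - f u) * deriv g z = (g v - g u) * deriv f z"
proof -
  let ?h = "\<lambda>t. (f v - f u) * g t - (g v - g u) * f t"
  have "?h u = ?h v"
    by (simp add: algebra_simps)
  moreover have "continuous_on {u..v} ?h"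
    by (intro continuous_intros assms)
  moreover have "?h differentiable at z" if "u < z" "z < v" for z
    using df[of z] dg[of z] that by (intro derivative_intros) auto
  ultimately obtain z where z: "u < z" "z < v" "(?h has_real_derivative 0) (at z)"
    using Rolle[of u v ?h] \<open>u < v\<close> by blast
  have "(f has_real_derivative deriv f z) (at z)" "(g has_real_derivative deriv g z) (at z)"
    using df[of z] dg[of z] z by (auto simp: DERIV_deriv_iff_real_differentiable)
  then have "(?h has_real_derivative ((f v - f u) * deriv g z - (g v - g u) * deriv f z)) (at z)"
    by (auto intro!: derivative_eq_intros)
  with z(3) have "(f v - f u) * deriv g z - (g v - g u) * deriv f z = 0"
    using DERIV_unique by blast
  with z show thesis
    by (intro that[of z]) auto
qed

text \<open>
  The quotient of the two increments is a value of \<open>f' / g'\<close> at an intermediate point. Stating this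
  as a product keeps the case of equal arguments.
\<close>

lemma increment_le_SUP_deriv_ratio:
  fixes f g :: "real \<Rightarrow> real"
  assumes contf: "continuous_on {a..b} f" and contg: "continuous_on {a..b} g"
    and df: "\<And>z. z \<in> {a<..<b} \<Longrightarrow> f differentiable at z"
    and dg: "\<And>z. z \<in> {a<..<b} \<Longrightarrow> g differentiable at z"
    and dg0: "\<And>z. z \<in> {a<..<b} \<Longrightarrow> deriv g z \<noteq> 0"
    and bdd: "bdd_above ((\<lambda>t. \<bar>deriv f t / deriv g t\<bar>) ` {a<..<b})"
    and "x \<in> {a..b}" "y \<in> {a..b}"
  shows "\<bar>f x - f y\<bar> \<le> (SUP t\<in>{a<..<b}. \<bar>deriv f t / deriv g t\<bar>) * \<bar>g x - g y\<bar>"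
  using \<open>x \<in> {a..b}\<close> \<open>y \<in> {a..b}\<close>
proof (induction x y rule: linorder_wlog)
  case (sym x y)
  then show ?case
    by (simp add: abs_minus_commute)
next
  case (le x y)
  show ?case
  proof (cases "x = y")
    case False
    with le have xy: "x < y" and sub: "{x..y} \<subseteq> {a..b}" "{x<..<y} \<subseteq> {a<..<b}"
      by auto
    obtain z where z: "z \<in> {x<..<y}"
      and eq: "(f y - f x) * deriv g z = (g y - g x) * deriv f z"
      using Cauchy_mean_value[OF xy continuous_on_subset[OF contf sub(1)]
          continuous_on_subset[OF contg sub(1)]] df dg sub(2) by blast
    have zab: "z \<in> {a<..<b}"
      using z sub(2) by blast
    have "f y - f x = deriv f z / deriv g z * (g y - g x)"
      using eq dg0[OF zab] by (simp add: field_simps)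
    then have "\<bar>f x - f y\<bar> = \<bar>deriv f z / deriv g z\<bar> * \<bar>g x - g y\<bar>"
      by (metis abs_minus_commute abs_mult)
    also have "\<dots> \<le> (SUP t\<in>{a<..<b}. \<bar>deriv f t / deriv g t\<bar>) * \<bar>g x - g y\<bar>"
      by (intro mult_right_mono cSUP_upper zab bdd) auto
    finally show ?thesis .
  qed simp
qed

lemma inj_on_of_deriv_nonzero:
  fixes g :: "real \<Rightarrow> real"
  assumes contg: "continuous_on {a..b} g"
    and dg: "\<And>z. z \<in> {a<..<b} \<Longrightarrow> g differentiable at z"
    and dg0: "\<And>z. z \<in> {a<..<b} \<Longrightarrow> deriv g z \<noteq> 0"
  shows "inj_on g {a..b}"
proof (rule linorder_inj_onI)
  fix u v
  assume uv: "u < v" "u \<in> {a..b}" "v \<in> {a..b}"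
  show "g u \<noteq> g v"
  proof
    assume "g u = g v"
    moreover have "continuous_on {u..v} g"
      using uv by (auto intro: continuous_on_subset[OF contg])
    ultimately obtain z where z: "u < z" "z < v" "(g has_real_derivative 0) (at z)"
      using Rolle[of u v g] dg uv by auto
    then show False
      using dg0[of z] uv by (auto dest: DERIV_imp_deriv)
  qed
qed auto

text \<open>
  Monotonicity fixes the sign of \<open>g x - g t\<close> on either side of \<open>x\<close>, so that splitting the
  integral at \<open>x\<close> removes the absolute value.
\<close>

lemma integral_abs_diff_mono:
  fixes g :: "real \<Rightarrow> real"
  assumes contg: "continuous_on {a..b} g" and mono: "mono_on {a..b} g" and x: "x \<in> {a..b}"
  shows "integral {a..b} (\<lambda>t. \<bar>g x - g t\<bar>)
    = (2 * x - (a + b)) * g x + (integral {x..b} g - integral {a..x} g)"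
proof -
  have int: "g integrable_on {a..x}" "g integrable_on {x..b}"
    using x by (auto intro!: integrable_continuous_real continuous_on_subset[OF contg])
  have left: "g t \<le> g x" if "t \<in> {a..x}" for t
    using that x by (intro mono_onD[OF mono]) auto
  have right: "g x \<le> g t" if "t \<in> {x..b}" for t
    using that x by (intro mono_onD[OF mono]) auto
  have "integral {a..b} (\<lambda>t. \<bar>g x - g t\<bar>)
      = integral {a..x} (\<lambda>t. \<bar>g x - g t\<bar>) + integral {x..b} (\<lambda>t. \<bar>g x - g t\<bar>)"
    using x by (subst Henstock_Kurzweil_Integration.integral_combine[where c = x])
      (auto intro!: integrable_continuous_real continuous_intros contg)
  also have "integral {a..x} (\<lambda>t. \<bar>g x - g t\<bar>) = integral {a..x} (\<lambda>t. g x - g t)"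
    by (intro integral_cong) (simp add: left)
  also have "\<dots> = (x - a) * g x - integral {a..x} g"
    using int x by (subst integral_diff) auto
  also have "integral {x..b} (\<lambda>t. \<bar>g x - g t\<bar>) = integral {x..b} (\<lambda>t. g t - g x)"
    by (intro integral_cong) (simp add: right)
  also have "\<dots> = integral {x..b} g - (b - x) * g x"
    using int x by (subst integral_diff) auto
  finally show ?thesis
    by (simp add: algebra_simps)
qed

text \<open>
  The absolute value on the right absorbs the direction of monotonicity: for antitone \<open>g\<close> the
  previous formula applies to \<open>- g\<close> and yields the opposite of the enclosed expression, while the
  integral on the left is nonnegative in either case.
\<close>

lemma integral_abs_diff_monotone:
  fixes g :: "real \<Rightarrow> real"
  assumes contg: "continuous_on {a..b} g"
    and mono: "mono_on {a..b} g \<or> antimono_on {a..b} g" and x: "x \<in> {a..b}"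
  shows "integral {a..b} (\<lambda>t. \<bar>g x - g t\<bar>)
    = \<bar>(2 * x - (a + b)) * g x + (integral {x..b} g - integral {a..x} g)\<bar>"
    (is "?I = \<bar>?E\<bar>")
proof -
  have nonneg: "?I \<ge> 0"
    by (intro integral_nonneg integrable_continuous_real continuous_intros contg) auto
  from mono show ?thesis
  proof
    assume "mono_on {a..b} g"
    with integral_abs_diff_mono[OF contg] x nonneg show ?thesis
      by simp
  next
    assume "antimono_on {a..b} g"
    then have "mono_on {a..b} (\<lambda>t. - g t)"
      by (auto simp: monotone_on_def)
    then have "integral {a..b} (\<lambda>t. \<bar>- g x - - g t\<bar>)
        = (2 * x - (a + b)) * - g x
          + (integral {x..b} (\<lambda>t. - g t) - integral {a..x} (\<lambda>t. - g t))"
      using x by (intro integral_abs_diff_mono continuous_intros contg)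
    then have "?I = - ?E"
      by (simp add: abs_minus_commute)
    with nonneg show ?thesis
      by simp
  qed
qed

text \<open>
  This isolates the part of the argument free of derivatives: they enter the final inequality
  only through the bound on increments and the monotonicity of \<open>g\<close>.
\<close>

lemma integral_deviation_le_of_increment_le:
  fixes f g :: "real \<Rightarrow> real"
  assumes "a < b" and contf: "continuous_on {a..b} f" and contg: "continuous_on {a..b} g"
    and mono: "mono_on {a..b} g \<or> antimono_on {a..b} g" and x: "x \<in> {a..b}"
    and le: "\<And>t. t \<in> {a..b} \<Longrightarrow> \<bar>f x - f t\<bar> \<le> M * \<bar>g x - g t\<bar>"
  shows "\<bar>f x - 1 / (b - a) * integral {a..b} f\<bar>
    \<le> \<bar>2 * ((x - (a + b) / 2) / (b - a)) * g x
        + (integral {x..b} g - integral {a..x} g) / (b - a)\<bar> * M"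
    (is "?lhs \<le> \<bar>?F\<bar> * M")
proof -
  let ?E = "(2 * x - (a + b)) * g x + (integral {x..b} g - integral {a..x} g)"
  have "integral {a..b} (\<lambda>t. f x - f t) = (b - a) * f x - integral {a..b} f"
    using \<open>a < b\<close> contf by (subst integral_diff) (auto intro: integrable_continuous_real)
  then have "f x - 1 / (b - a) * integral {a..b} f = integral {a..b} (\<lambda>t. f x - f t) / (b - a)"
    using \<open>a < b\<close> by (simp add: field_simps)
  then have "?lhs = \<bar>integral {a..b} (\<lambda>t. f x - f t)\<bar> / (b - a)"
    using \<open>a < b\<close> by simp
  also have "\<bar>integral {a..b} (\<lambda>t. f x - f t)\<bar> \<le> integral {a..b} (\<lambda>t. M * \<bar>g x - g t\<bar>)"
    unfolding real_norm_def[symmetric]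
    by (intro integral_norm_bound_integral integrable_continuous_real continuous_intros
        contf contg) (use le in auto)
  also have "\<dots> = M * \<bar>?E\<bar>"
    using integral_abs_diff_monotone[OF contg mono x] by simp
  also have "M * \<bar>?E\<bar> / (b - a) = \<bar>?E / (b - a)\<bar> * M"
    using \<open>a < b\<close> by simp
  also have "?E / (b - a) = ?F"
  proof -
    have "2 * x - (a + b) = 2 * (x - (a + b) / 2)"
      by (simp add: field_simps)
    then show ?thesis
      by (metis add_divide_distrib times_divide_eq_left times_divide_eq_right)
  qed
  finally show ?thesis
    using \<open>a < b\<close> by (simp add: divide_right_mono)
qed

theorem theorem5:
  fixes f g :: "real \<Rightarrow> real" and a b x :: real
  assumes "a < b"
    and "continuous_on {a..b} f" and "continuous_on {a..b} g"
    and "f differentiable_on {a<..<b}" and "g differentiable_on {a<..<b}"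
    and "\<And>t. t \<in> {a<..<b} \<Longrightarrow> deriv g t \<noteq> 0"
    and "bdd_above ((\<lambda>t. \<bar>deriv f t / deriv g t\<bar>) ` {a<..<b})"
    and "x \<in> {a..b}"
  shows "\<bar>f x - 1 / (b - a) * integral {a..b} f\<bar>
    \<le> \<bar>2 * ((x - (a + b) / 2) / (b - a)) * g x
        + (integral {x..b} g - integral {a..x} g) / (b - a)\<bar>
      * (SUP t\<in>{a<..<b}. \<bar>deriv f t / deriv g t\<bar>)"
proof (rule integral_deviation_le_of_increment_le)
  have df: "f differentiable at z" and dg: "g differentiable at z" if "z \<in> {a<..<b}" for z
    using assms(4,5) that by (auto simp: differentiable_on_eq_differentiable_at)
  have "inj_on g {a..b}"
    using assms(3,6) dg by (intro inj_on_of_deriv_nonzero)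
  then have "strict_mono_on {a..b} g \<or> strict_antimono_on {a..b} g"
    using injective_eq_monotone_map[of "{a..b}" g] assms(3) by (simp add: is_interval_cc)
  then show "mono_on {a..b} g \<or> antimono_on {a..b} g"
    by (auto simp: strict_mono_iff_mono strict_antimono_iff_antimono)
  show "\<bar>f x - f t\<bar> \<le> (SUP t\<in>{a<..<b}. \<bar>deriv f t / deriv g t\<bar>) * \<bar>g x - g t\<bar>"
    if "t \<in> {a..b}" for t
    using assms df dg that by (intro increment_le_SUP_deriv_ratio)
qed (fact assms)+

end
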